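(* Let $R$ be any TRS over $sign(R)$, and let $\Sigma=\{f,\sharp\}\cup sign(R)$, where $f\in\Sigma_2-sign(R)$ and $\sharp\in\Sigma_0-sign(R)$. Then $R$ is a P$\Sigma$RF-TRS if and only if $R$ is a PRF-TRS.
   Context: A ranked alphabet $\Sigma$ is a finite set of symbols with ranks, $\Sigma_m$ the symbols of rank $m$; $X$ a countable set of variables, $T_\Sigma(X)$ the terms, $T_\Sigma$ the ground terms. A TRS $R$ is a finite set of rules $l\to r$ of terms with every variable of $r$ occurring in $l$; $sign(R)$ is the ranked alphabet of symbols in its rules. $R^*_\Gamma(L)=\{p\mid q\Rightarrow^*_R p,\ q\in L\}$ for $L\subseteq T_\Gamma$ (with $R$ regarded as a TRS over $\Gamma$). A tree language is recognizable if recognized by a bottom-up tree automaton. $R$ is a P$\Gamma$RF-TRS if $R^*_\Gamma(L)$ is recognizable for every finite $L\subseteq T_\Gamma$. $R$ is a PRF-TRS if it is a P$\Gamma$RF-TRS for every ranked alphabet $\Gamma\supseteq sign(R)$. *)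

theory Defs
  imports Main "HOL-Library.Countable" "HOL-Library.Infinite_Typeclass"
begin

text \<open>A ranked alphabet is a finite set of pairs (symbol, rank) in which every symbol
  has exactly one rank.\<close>

type_synonym 'f alphabet = "('f \<times> nat) set"

definition ranked_alphabet :: "'f alphabet \<Rightarrow> bool" where
  "ranked_alphabet \<Gamma> \<longleftrightarrow> finite \<Gamma> \<and> single_valued \<Gamma>"

definition symbols :: "'f alphabet \<Rightarrow> 'f set" where
  "symbols \<Gamma> = fst ` \<Gamma>"

definition symbols_of_rank :: "'f alphabet \<Rightarrow> nat \<Rightarrow> 'f set" where
  "symbols_of_rank \<Gamma> m = {g. (g, m) \<in> \<Gamma>}"

datatype (dead 'f, vars: 'v) trm = Var 'v | Fun 'f "('f, 'v) trm list"

primrec ranked_syms :: "('f, 'v) trm \<Rightarrow> 'f alphabet" where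
  "ranked_syms (Var x) = {}"
| "ranked_syms (Fun g ts) = insert (g, length ts) (\<Union> (set (map ranked_syms ts)))"

definition terms_over :: "'f alphabet \<Rightarrow> ('f, 'v) trm set" where
  "terms_over \<Gamma> = {t. ranked_syms t \<subseteq> \<Gamma>}"

definition ground_terms :: "'f alphabet \<Rightarrow> ('f, 'v) trm set" where
  "ground_terms \<Gamma> = {t \<in> terms_over \<Gamma>. vars t = {}}"

primrec subst :: "('v \<Rightarrow> ('f, 'v) trm) \<Rightarrow> ('f, 'v) trm \<Rightarrow> ('f, 'v) trm" where
  "subst \<sigma> (Var x) = \<sigma> x"
| "subst \<sigma> (Fun g ts) = Fun g (map (subst \<sigma>) ts)"

type_synonym ('f, 'v) trs = "(('f, 'v) trm \<times> ('f, 'v) trm) set"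

definition sign :: "('f, 'v) trs \<Rightarrow> 'f alphabet" where
  "sign R = (\<Union>(l, r)\<in>R. ranked_syms l \<union> ranked_syms r)"

text \<open>Left-hand sides are allowed to be variables.\<close>

definition trs_over :: "'f alphabet \<Rightarrow> ('f, 'v) trs \<Rightarrow> bool" where
  "trs_over \<Gamma> R \<longleftrightarrow> ranked_alphabet \<Gamma> \<and> finite R \<and>
     (\<forall>(l, r)\<in>R. l \<in> terms_over \<Gamma> \<and> r \<in> terms_over \<Gamma> \<and> vars r \<subseteq> vars l)"

inductive rewrite_step :: "('f, 'v) trs \<Rightarrow> ('f, 'v) trm \<Rightarrow> ('f, 'v) trm \<Rightarrow> bool"
  for R where
  root: "(l, r) \<in> R \<Longrightarrow> rewrite_step R (subst \<sigma> l) (subst \<sigma> r)"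
| arg: "rewrite_step R s t \<Longrightarrow>
    rewrite_step R (Fun g (us @ s # vs)) (Fun g (us @ t # vs))"

definition rewrite_rel :: "'f alphabet \<Rightarrow> ('f, 'v) trs \<Rightarrow> ('f, 'v) trm rel" where
  "rewrite_rel \<Gamma> R =
     {(s, t). s \<in> terms_over \<Gamma> \<and> t \<in> terms_over \<Gamma> \<and> rewrite_step R s t}"

definition descendants ::
  "'f alphabet \<Rightarrow> ('f, 'v) trs \<Rightarrow> ('f, 'v) trm set \<Rightarrow> ('f, 'v) trm set" where
  "descendants \<Gamma> R L = {p. \<exists>q\<in>L. (q, p) \<in> (rewrite_rel \<Gamma> R)\<^sup>*}"

text \<open>Bottom-up tree automata are nondeterministic and without epsilon transitions;
  a transition (g, [q1, ..., qm], q) stands for the rule g(q1, ..., qm) to q.\<close>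

record ('q, 'f) tree_automaton =
  states :: "'q set"
  finals :: "'q set"
  transitions :: "('f \<times> 'q list \<times> 'q) set"

definition automaton_over :: "'f alphabet \<Rightarrow> ('q, 'f) tree_automaton \<Rightarrow> bool" where
  "automaton_over \<Gamma> A \<longleftrightarrow> finite (states A) \<and> finals A \<subseteq> states A \<and>
     (\<forall>(g, qs, q)\<in>transitions A. (g, length qs) \<in> \<Gamma> \<and> set qs \<subseteq> states A \<and> q \<in> states A)"

inductive reaches :: "('q, 'f) tree_automaton \<Rightarrow> ('f, 'v) trm \<Rightarrow> 'q \<Rightarrow> bool"
  for A where
  "(g, qs, q) \<in> transitions A \<Longrightarrow> list_all2 (reaches A) ts qs \<Longrightarrow> reaches A (Fun g ts) q"

definition tree_language ::
  "'f alphabet \<Rightarrow> ('q, 'f) tree_automaton \<Rightarrow> ('f, 'v) trm set" where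
  "tree_language \<Gamma> A = {t \<in> ground_terms \<Gamma>. \<exists>q\<in>finals A. reaches A t q}"

text \<open>State sets are finite, so taking states from \<^typ>\<open>nat\<close> is no restriction.\<close>

definition recognizable :: "'f alphabet \<Rightarrow> ('f, 'v) trm set \<Rightarrow> bool" where
  "recognizable \<Gamma> L \<longleftrightarrow>
     (\<exists>A :: (nat, 'f) tree_automaton. automaton_over \<Gamma> A \<and> L = tree_language \<Gamma> A)"

definition PGRF_TRS :: "'f alphabet \<Rightarrow> ('f, 'v) trs \<Rightarrow> bool" where
  "PGRF_TRS \<Gamma> R \<longleftrightarrow>
     (\<forall>L. finite L \<and> L \<subseteq> ground_terms \<Gamma> \<longrightarrow> recognizable \<Gamma> (descendants \<Gamma> R L))"

text \<open>The universe of symbols is required to be infinite so that, up to renaming of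
  symbols outside of \<^term>\<open>sign R\<close>, every ranked alphabet extending \<^term>\<open>sign R\<close> is
  covered by the quantifier.\<close>

definition PRF_TRS :: "('f :: infinite, 'v) trs \<Rightarrow> bool" where
  "PRF_TRS R \<longleftrightarrow> (\<forall>\<Gamma>. ranked_alphabet \<Gamma> \<and> sign R \<subseteq> \<Gamma> \<longrightarrow> PGRF_TRS \<Gamma> R)"

end

theory Submission imports Defs
begin

text \<open>A term over \<open>\<Gamma>\<close> is encoded over \<open>\<Sigma>\<close> by replacing \<open>g(t\<^sub>1, \<dots>, t\<^sub>k)\<close>, for \<open>g\<close> outside of
  \<open>sign(R)\<close>, by a right comb \<open>f(t\<^sub>1, \<dots> f(t\<^sub>k, f(\<sharp>, \<dots> f(\<sharp>, \<sharp>))))\<close> whose length identifies \<open>g\<close>.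
  Rewriting \<open>\<Gamma>\<close>-terms carries over to their codes. Conversely, rules whose left-hand side is a variable can
  rewrite inside a comb and destroy it; the decoding therefore moves every context over
  \<open>sign(R)\<close> found on the spine of a comb above that comb, so that \<open>f(x, C[y])\<close> is read like
  \<open>C[f(x, y)]\<close>. The decoding commutes with the symbols of \<open>sign(R)\<close> and hence
  maps each rewrite step to a rewrite sequence. So the descendants of \<open>L\<close> over \<open>\<Gamma>\<close> are the inverse
  image, under the encoding homomorphism, of the descendants over \<open>\<Sigma>\<close> of the code of \<open>L\<close>.\<close>

section \<open>Rewriting\<close>

lemma ranked_syms_subst:
  "ranked_syms (subst \<sigma> t) = ranked_syms t \<union> (\<Union>x\<in>vars t. ranked_syms (\<sigma> x))"
  by (induction t) auto

lemma vars_subst: "vars (subst \<sigma> t) = (\<Union>x\<in>vars t. vars (\<sigma> x))"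
  by (induction t) auto

lemma rewrite_step_vars_syms:
  assumes "rewrite_step R s t" and "trs_over \<Delta> R"
  shows "vars t \<subseteq> vars s \<and> ranked_syms t \<subseteq> ranked_syms s \<union> \<Delta>"
  using assms(1)
proof induction
  case (root l r \<sigma>)
  then have "ranked_syms r \<subseteq> \<Delta>" "vars r \<subseteq> vars l"
    using assms(2) by (auto simp: trs_over_def terms_over_def)
  then show ?case
    by (auto simp: ranked_syms_subst vars_subst)
qed auto

lemma rewrite_steps_vars_syms:
  assumes "(rewrite_step R)\<^sup>*\<^sup>* s t" and "trs_over \<Delta> R"
  shows "vars t \<subseteq> vars s \<and> ranked_syms t \<subseteq> ranked_syms s \<union> \<Delta>"
  using assms(1)
proof induction
  case (step t u)
  then show ?case
    using rewrite_step_vars_syms[OF step(2) assms(2)] by blast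
qed auto

lemma rewrite_rel_rtrancl_iff:
  assumes "trs_over \<Delta> R" and "\<Delta> \<subseteq> \<Gamma>" and s: "s \<in> terms_over \<Gamma>"
  shows "(s, t) \<in> (rewrite_rel \<Gamma> R)\<^sup>* \<longleftrightarrow> (rewrite_step R)\<^sup>*\<^sup>* s t"
proof
  assume "(s, t) \<in> (rewrite_rel \<Gamma> R)\<^sup>*"
  then show "(rewrite_step R)\<^sup>*\<^sup>* s t"
    by induction (auto simp: rewrite_rel_def intro: rtranclp.rtrancl_into_rtrancl)
next
  assume "(rewrite_step R)\<^sup>*\<^sup>* s t"
  then show "(s, t) \<in> (rewrite_rel \<Gamma> R)\<^sup>*"
  proof induction
    case (step t u)
    have "t \<in> terms_over \<Gamma>" "u \<in> terms_over \<Gamma>"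
      using rewrite_steps_vars_syms[OF step(1) assms(1)]
        rewrite_step_vars_syms[OF step(2) assms(1)] s assms(2)
      unfolding terms_over_def by blast+
    then show ?case
      using step by (auto simp: rewrite_rel_def intro: rtrancl_into_rtrancl)
  qed auto
qed

lemma descendants_eq:
  assumes "trs_over \<Delta> R" and "\<Delta> \<subseteq> \<Gamma>" and "L \<subseteq> terms_over \<Gamma>"
  shows "descendants \<Gamma> R L = {p. \<exists>q\<in>L. (rewrite_step R)\<^sup>*\<^sup>* q p}"
  using rewrite_rel_rtrancl_iff[OF assms(1,2)] assms(3) unfolding descendants_def by blast

lemma descendants_subset_ground_terms:
  assumes "trs_over \<Delta> R" and "\<Delta> \<subseteq> \<Gamma>" and "L \<subseteq> ground_terms \<Gamma>"
  shows "descendants \<Gamma> R L \<subseteq> ground_terms \<Gamma>"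
proof
  fix p assume "p \<in> descendants \<Gamma> R L"
  moreover have "L \<subseteq> terms_over \<Gamma>"
    using assms(3) by (auto simp: ground_terms_def)
  ultimately obtain q where "q \<in> L" "(rewrite_step R)\<^sup>*\<^sup>* q p"
    using descendants_eq[OF assms(1,2)] by auto
  then show "p \<in> ground_terms \<Gamma>"
    using rewrite_steps_vars_syms[OF _ assms(1), of q p] assms(2,3)
    unfolding ground_terms_def terms_over_def by blast
qed

lemma rewrite_steps_arg:
  "(rewrite_step R)\<^sup>*\<^sup>* s t \<Longrightarrow>
    (rewrite_step R)\<^sup>*\<^sup>* (Fun g (us @ s # vs)) (Fun g (us @ t # vs))"
  by (induction rule: rtranclp_induct)
    (auto intro: rtranclp.rtrancl_into_rtrancl rewrite_step.arg)

lemma rewrite_steps_args: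
  assumes "list_all2 (rewrite_step R)\<^sup>*\<^sup>* ss ts"
  shows "(rewrite_step R)\<^sup>*\<^sup>* (Fun g ss) (Fun g ts)"
proof -
  \<comment> \<open>\<open>us\<close> collects the arguments already rewritten, so it must vary in
    the induction.\<close>
  have "(rewrite_step R)\<^sup>*\<^sup>* (Fun g (us @ ss)) (Fun g (us @ ts))" for us
    using assms
  proof (induction arbitrary: us rule: list_all2_induct)
    case (Cons s ss t ts)
    have "(rewrite_step R)\<^sup>*\<^sup>* (Fun g (us @ s # ss)) (Fun g (us @ t # ss))"
      by (rule rewrite_steps_arg) (rule Cons)
    also have "(rewrite_step R)\<^sup>*\<^sup>* (Fun g (us @ t # ss)) (Fun g (us @ t # ts))"
      using Cons.IH[of "us @ [t]"] by simp
    finally show ?case .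
  qed simp
  from this[of "[]"] show ?thesis by simp
qed

section \<open>Encoding and decoding\<close>

text \<open>\<open>\<Delta>\<close> stands for \<open>sign R\<close>. Newness of \<open>f\<close>
  and \<open>sharp\<close> is relative to \<open>\<Delta>\<close>: where they occur in
  \<open>\<Gamma> - \<Delta>\<close>, they are themselves encoded by combs.\<close>

locale comb_coding =
  fixes \<Gamma> \<Delta> :: "'f alphabet" and f sharp :: 'f and len :: "'f \<times> nat \<Rightarrow> nat"
  assumes f_new: "(f, 2) \<notin> \<Delta>" and sharp_new: "(sharp, 0) \<notin> \<Delta>"
    and len_inj: "inj_on len (\<Gamma> - \<Delta>)"
    and len_ge: "(g, k) \<in> \<Gamma> - \<Delta> \<Longrightarrow> k \<le> len (g, k)"
begin

definition comb :: "('f, 'v) trm list \<Rightarrow> ('f, 'v) trm" where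
  "comb ts = foldr (\<lambda>t u. Fun f [t, u]) ts (Fun sharp [])"

lemma comb_simps [simp]:
  "comb [] = Fun sharp []" "comb (t # ts) = Fun f [t, comb ts]"
  by (simp_all add: comb_def)

definition pad :: "'f \<Rightarrow> nat \<Rightarrow> ('f, 'v) trm list" where
  "pad g k = replicate (len (g, k) - k) (Fun sharp [])"

fun enc :: "('f, 'v) trm \<Rightarrow> ('f, 'v) trm" where
  "enc (Var x) = Var x"
| "enc (Fun g ts) =
    (if (g, length ts) \<in> \<Delta> then Fun g (map enc ts)
     else comb (map enc ts @ pad g (length ts)))"

text \<open>On lists whose length is not a code the value is arbitrary, but it depends on the length
  only up to rewriting of the entries, which is all that the simulation needs.\<close>

definition build :: "('f, 'v) trm list \<Rightarrow> ('f, 'v) trm" where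
  "build ts = (let (g, k) = (SOME p. p \<in> \<Gamma> - \<Delta> \<and> len p = length ts) in Fun g (take k ts))"

text \<open>The accumulator holds the decoded entries of the comb read so far; a symbol of \<open>\<Delta>\<close> on the
  spine is emitted at once, each of its arguments continuing the comb.\<close>

fun dec :: "('f, 'v) trm list \<Rightarrow> ('f, 'v) trm \<Rightarrow> ('f, 'v) trm" where
  "dec acc (Var x) = Var x"
| "dec acc (Fun g ts) =
    (if (g, length ts) \<in> \<Delta> then Fun g (map (dec acc) ts)
     else if g = f then
       (case ts of [t, u] \<Rightarrow> dec (acc @ [dec [] t]) u | _ \<Rightarrow> build acc)
     else build acc)"

section \<open>Decoding inverts encoding\<close>

lemma vars_comb: "vars (comb ts) = (\<Union>t\<in>set ts. vars t)"
  by (induction ts) auto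

lemma ranked_syms_comb:
  "ranked_syms (comb ts) \<subseteq> {(f, 2), (sharp, 0)} \<union> (\<Union>t\<in>set ts. ranked_syms t)"
  by (induction ts) (auto simp: numeral_2_eq_2)

lemma vars_enc: "vars (enc t) = vars t"
  by (induction t) (auto simp: vars_comb pad_def)

lemma ranked_syms_enc: "ranked_syms (enc t) \<subseteq> {(f, 2), (sharp, 0)} \<union> \<Delta>"
proof (induction t)
  case (Fun g ts)
  have "ranked_syms t \<subseteq> {(f, 2), (sharp, 0)} \<union> \<Delta>"
    if "t \<in> set (map enc ts @ pad g (length ts))" for t
    using that Fun.IH by (auto simp: pad_def)
  then have "ranked_syms (comb (map enc ts @ pad g (length ts))) \<subseteq> {(f, 2), (sharp, 0)} \<union> \<Delta>"
    using ranked_syms_comb[of "map enc ts @ pad g (length ts)"] by blast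
  moreover have "(\<Union>t\<in>set ts. ranked_syms (enc t)) \<subseteq> {(f, 2), (sharp, 0)} \<union> \<Delta>"
    using Fun.IH by blast
  ultimately show ?case by auto
qed auto

lemma enc_subst:
  "ranked_syms t \<subseteq> \<Delta> \<Longrightarrow> enc (subst \<sigma> t) = subst (\<lambda>x. enc (\<sigma> x)) t"
  by (induction t) (auto simp: UN_subset_iff)

text \<open>A symbol of \<open>\<Delta>\<close> hands \<open>acc\<close> on unchanged to each
  argument. Hence an instance of a rule side decodes to an instance of the same side, even on the
  spine of a comb or if that side is a variable.\<close>

lemma dec_subst:
  "ranked_syms t \<subseteq> \<Delta> \<Longrightarrow> dec acc (subst \<sigma> t) = subst (\<lambda>x. dec acc (\<sigma> x)) t"
  by (induction t) (auto simp: UN_subset_iff)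

text \<open>By \<open>f_new\<close> and \<open>sharp_new\<close> no cell of the comb is mistaken for
  a symbol of \<open>\<Delta>\<close>, so the accumulator collects the entries in order up to the
  final \<open>sharp\<close>.\<close>

lemma dec_comb: "dec acc (comb ts) = build (acc @ map (dec []) ts)"
proof (induction ts arbitrary: acc)
  case Nil
  then show ?case using sharp_new by simp
next
  case (Cons t ts)
  then show ?case using f_new by (simp add: numeral_2_eq_2)
qed

text \<open>Injectivity of \<open>len\<close> makes the choice in \<open>build\<close> unique, and
  \<open>len_ge\<close> keeps the subtraction from truncating; \<open>take\<close> then removes
  \<open>us\<close>.\<close>

lemma build_code:
  assumes "(g, k) \<in> \<Gamma> - \<Delta>" and "length ts = k" and "length us = len (g, k) - k"
  shows "build (ts @ us) = Fun g ts"
proof -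
  have "length (ts @ us) = len (g, k)"
    using assms len_ge[OF assms(1)] by simp
  then have "(SOME p. p \<in> \<Gamma> - \<Delta> \<and> len p = length (ts @ us)) = (g, k)"
    using assms(1) len_inj by (intro some_equality) (auto dest: inj_onD)
  then show ?thesis
    using assms(2) by (simp only: build_def Let_def) simp
qed

lemma dec_enc: "ranked_syms t \<subseteq> \<Gamma> \<Longrightarrow> dec [] (enc t) = t"
proof (induction t)
  case (Fun g ts)
  then have IH: "map (dec [] \<circ> enc) ts = ts"
    by (intro map_idI) auto
  show ?case
  proof (cases "(g, length ts) \<in> \<Delta>")
    case True
    then show ?thesis using IH by simp
  next
    case False
    \<comment> \<open>What the padding decodes to is irrelevant: only its length counts, since
      \<open>build\<close> cuts it off.\<close>
    then have "build (ts @ map (dec []) (pad g (length ts))) = Fun g ts"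
      using Fun.prems by (intro build_code) (auto simp: pad_def)
    then show ?thesis
      using IH False by (simp add: dec_comb)
  qed
qed auto

section \<open>Encoding and decoding respect rewriting\<close>

lemma rewrite_step_comb:
  "rewrite_step R s t \<Longrightarrow> rewrite_step R (comb (us @ s # vs)) (comb (us @ t # vs))"
proof (induction us)
  case Nil
  then show ?case using rewrite_step.arg[of R s t f "[]"] by simp
next
  case (Cons u us)
  then show ?case
    using rewrite_step.arg[of R "comb (us @ s # vs)" "comb (us @ t # vs)" f "[u]" "[]"] by simp
qed

text \<open>Rule sides are over \<open>\<Delta>\<close> and hence copied verbatim, and each argument
  occurs exactly once in a code, so one step remains one step.\<close>

lemma rewrite_step_enc:
  assumes "trs_over \<Delta> R" and "rewrite_step R s t"
  shows "rewrite_step R (enc s) (enc t)"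
  using assms(2)
proof induction
  case (root l r \<sigma>)
  then have "ranked_syms l \<subseteq> \<Delta>" "ranked_syms r \<subseteq> \<Delta>"
    using assms(1) by (auto simp: trs_over_def terms_over_def)
  with root show ?case
    by (simp add: enc_subst rewrite_step.root)
next
  case (arg s t g us vs)
  then show ?case
    using rewrite_step.arg[OF arg.IH]
      rewrite_step_comb[OF arg.IH, of "map enc us"] by simp
qed

lemma rewrite_steps_enc:
  assumes "trs_over \<Delta> R" and "(rewrite_step R)\<^sup>*\<^sup>* s t"
  shows "(rewrite_step R)\<^sup>*\<^sup>* (enc s) (enc t)"
  using assms(2)
  by induction (auto intro: rtranclp.rtrancl_into_rtrancl rewrite_step_enc[OF assms(1)])

text \<open>Both lists have the same length, so \<open>build\<close> chooses the same symbol and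
  rank for both, whether or not the length is a code.\<close>

lemma rewrite_steps_build:
  assumes "list_all2 (rewrite_step R)\<^sup>*\<^sup>* ss ts"
  shows "(rewrite_step R)\<^sup>*\<^sup>* (build ss) (build ts)"
proof -
  have "length ss = length ts"
    using assms by (rule list_all2_lengthD)
  then show ?thesis
    using assms unfolding build_def Let_def
    by (auto split: prod.split intro!: rewrite_steps_args list_all2_takeI)
qed

text \<open>Symbols of \<open>\<Delta>\<close> on the spine copy or erase the accumulator, and
  \<open>build\<close> may truncate it; a step in one entry thus becomes several steps or
  none.\<close>

lemma rewrite_steps_dec_acc:
  assumes "list_all2 (rewrite_step R)\<^sup>*\<^sup>* acc acc'"
  shows "(rewrite_step R)\<^sup>*\<^sup>* (dec acc t) (dec acc' t)"
  using assms
proof (induction acc t arbitrary: acc' rule: dec.induct)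
  case (2 acc g ts)
  consider "(g, length ts) \<in> \<Delta>"
    | t u where "(g, length ts) \<notin> \<Delta>" "g = f" "ts = [t, u]"
    | "(g, length ts) \<notin> \<Delta>" "g \<noteq> f \<or> (\<nexists>t u. ts = [t, u])"
    by blast
  then show ?case
  proof cases
    case 1
    then show ?thesis
      using 2 by (auto simp: list_all2_conv_all_nth intro!: rewrite_steps_args)
  next
    case 2
    \<comment> \<open>The new entry is decoded with the empty accumulator and so agrees on both
      sides.\<close>
    moreover have "list_all2 (rewrite_step R)\<^sup>*\<^sup>* (acc @ [dec [] t]) (acc' @ [dec [] t])"
      using "2.prems" by (simp add: list_all2_appendI)
    ultimately show ?thesis
      using "2.IH"(3) by simp
  next
    case 3
    then have "dec acc (Fun g ts) = build acc" "dec acc' (Fun g ts) = build acc'"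
      by (auto split: list.split)
    then show ?thesis
      using rewrite_steps_build[OF "2.prems"] by simp
  qed
qed auto

text \<open>In a comb cell, a step on the left rewrites an accumulator entry, while a step on the
  right happens under a longer accumulator; therefore \<open>acc\<close> is arbitrary in the
  induction.\<close>

lemma rewrite_steps_dec_step:
  fixes R :: "('f, 'v) trs"
  assumes "trs_over \<Delta> R" and "rewrite_step R s t"
  shows "(rewrite_step R)\<^sup>*\<^sup>* (dec acc s) (dec acc t)"
  using assms(2)
proof (induction arbitrary: acc)
  case (root l r \<sigma>)
  then have "ranked_syms l \<subseteq> \<Delta>" "ranked_syms r \<subseteq> \<Delta>"
    using assms(1) by (auto simp: trs_over_def terms_over_def)
  with root show ?case
    by (simp add: dec_subst rewrite_step.root r_into_rtranclp)
next
  case (arg s t g us vs)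
  let ?ss = "us @ s # vs" and ?ts = "us @ t # vs"
  consider "(g, length ?ss) \<in> \<Delta>"
    | "(g, length ?ss) \<notin> \<Delta>" "g = f" "length ?ss = 2"
    | "(g, length ?ss) \<notin> \<Delta>" "g \<noteq> f \<or> length ?ss \<noteq> 2"
    by blast
  then show ?case
  proof cases
    case 1
    then show ?thesis
      using rewrite_steps_arg[OF arg.IH] by simp
  next
    case 2
    then consider v where "us = []" "vs = [v]" | u where "us = [u]" "vs = []"
      by (cases us; cases vs) auto
    then show ?thesis
    proof cases
      case 1
      note left = 1
      have "list_all2 (rewrite_step R)\<^sup>*\<^sup>* (acc @ [dec [] s]) (acc @ [dec [] t])"
        using arg.IH by (simp add: list_all2_appendI list_all2_refl)
      then show ?thesis
        using left \<open>g = f\<close> \<open>(g, length ?ss) \<notin> \<Delta>\<close> by (simp add: rewrite_steps_dec_acc)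
    next
      case right: 2
      then show ?thesis
        using \<open>g = f\<close> \<open>(g, length ?ss) \<notin> \<Delta>\<close> arg.IH by simp
    qed
  next
    case 3
    \<comment> \<open>Here decoding stops without looking at the arguments, so the step
      disappears.\<close>
    then have "dec acc (Fun g ws) = build acc" if "length ws = length ?ss" for ws :: "('f, 'v) trm list"
      using that by (auto split: list.split)
    from this[of ?ss] this[of ?ts] show ?thesis
      by (simp del: dec.simps)
  qed
qed

lemma rewrite_steps_dec:
  assumes "trs_over \<Delta> R" and "(rewrite_step R)\<^sup>*\<^sup>* s t"
  shows "(rewrite_step R)\<^sup>*\<^sup>* (dec acc s) (dec acc t)"
  using assms(2)
  by induction (auto intro: rtranclp_trans rewrite_steps_dec_step[OF assms(1)])

text \<open>A sequence between two codes may pass through terms that are not codes; decoding is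
  total and maps the whole sequence back, with the end points recovered by
  \<open>dec_enc\<close>.\<close>

lemma rewrite_steps_enc_iff:
  assumes "trs_over \<Delta> R" and "s \<in> terms_over \<Gamma>" and "t \<in> terms_over \<Gamma>"
  shows "(rewrite_step R)\<^sup>*\<^sup>* (enc s) (enc t) \<longleftrightarrow> (rewrite_step R)\<^sup>*\<^sup>* s t"
  using rewrite_steps_dec[OF assms(1), of "enc s" "enc t" "[]"] rewrite_steps_enc[OF assms(1)]
    assms(2,3) by (auto simp: dec_enc terms_over_def)

lemma enc_ground_terms:
  "t \<in> ground_terms \<Gamma> \<Longrightarrow> enc t \<in> ground_terms ({(f, 2), (sharp, 0)} \<union> \<Delta>)"
  using ranked_syms_enc[of t] by (auto simp: ground_terms_def terms_over_def vars_enc)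

section \<open>Inverse images of recognizable languages\<close>

fun comb_run :: "('q, 'f) tree_automaton \<Rightarrow> 'q list \<Rightarrow> 'q \<Rightarrow> bool" where
  "comb_run A [] q \<longleftrightarrow> (sharp, [], q) \<in> transitions A"
| "comb_run A (p # ps) q \<longleftrightarrow> (\<exists>q'. comb_run A ps q' \<and> (f, [p, q'], q) \<in> transitions A)"

lemma reaches_Fun_iff:
  "reaches A (Fun g ts) q \<longleftrightarrow>
    (\<exists>qs. (g, qs, q) \<in> transitions A \<and> list_all2 (reaches A) ts qs)"
  by (subst reaches.simps) auto

lemma reaches_comb_iff:
  "reaches A (comb ts) q \<longleftrightarrow> (\<exists>ps. list_all2 (reaches A) ts ps \<and> comb_run A ps q)"
proof (induction ts arbitrary: q)
  case Nil
  then show ?case by (simp add: reaches_Fun_iff)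
next
  case (Cons t ts)
  then show ?case
    by (fastforce simp: reaches_Fun_iff list_all2_Cons1)
qed

lemma reaches_state:
  assumes "automaton_over \<Sigma> A" and "reaches A t q"
  shows "q \<in> states A"
  using assms(2,1) by cases (auto simp: automaton_over_def)

text \<open>The inverse homomorphism construction: a transition at \<open>g\<close> summarizes a run
  of \<open>A\<close> on the comb for \<open>g\<close>. Padding is ground, so its variable type can
  be fixed as \<open>unit\<close>.\<close>

definition enc_preimage :: "('q, 'f) tree_automaton \<Rightarrow> ('q, 'f) tree_automaton" where
  "enc_preimage A = \<lparr>states = states A, finals = finals A,
     transitions = {(g, qs, q). (g, length qs) \<in> \<Gamma> \<and> set qs \<subseteq> states A \<and> q \<in> states A \<and>
       (if (g, length qs) \<in> \<Delta> then (g, qs, q) \<in> transitions A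
        else \<exists>ps. comb_run A (qs @ ps) q \<and>
          list_all2 (reaches A) (pad g (length qs) :: ('f, unit) trm list) ps)}\<rparr>"

text \<open>The right-hand side is independent of the variable type, which lets runs on the padding
  pass between \<open>unit\<close> and \<open>'v\<close>.\<close>

lemma list_all2_reaches_pad:
  "list_all2 (reaches A) (pad g k :: ('f, 'v) trm list) ps \<longleftrightarrow>
    length ps = len (g, k) - k \<and> (\<forall>p\<in>set ps. (sharp, [], p) \<in> transitions A)"
  by (auto simp: pad_def list_all2_conv_all_nth reaches_Fun_iff all_set_conv_all_nth)

lemma reaches_enc_preimage_iff:
  fixes t :: "('f, 'v) trm"
  assumes A: "automaton_over \<Sigma> A" and "t \<in> ground_terms \<Gamma>"
  shows "reaches (enc_preimage A) t q \<longleftrightarrow> reaches A (enc t) q"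
  using assms(2)
proof (induction t arbitrary: q)
  case (Var x)
  then show ?case by (simp add: ground_terms_def)
next
  case (Fun g ts)
  have sub: "t \<in> ground_terms \<Gamma>" if "t \<in> set ts" for t
    using that Fun.prems by (auto simp: ground_terms_def terms_over_def)
  have args: "list_all2 (reaches (enc_preimage A)) ts qs \<longleftrightarrow> list_all2 (reaches A) (map enc ts) qs"
    for qs
    using Fun.IH sub by (auto simp: list_all2_conv_all_nth)
  \<comment> \<open>This supplies the membership conditions on states in the transitions of
    \<open>enc_preimage\<close>.\<close>
  have st: "set qs \<subseteq> states A" if "list_all2 (reaches A) us qs" for us :: "('f, 'v) trm list" and qs
    using that reaches_state[OF A] by (fastforce simp: list_all2_conv_all_nth in_set_conv_nth)
  have mem: "(g, length ts) \<in> \<Gamma>"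
    using Fun.prems by (auto simp: ground_terms_def terms_over_def)
  show ?case (is "?L \<longleftrightarrow> ?R")
  proof
    assume ?L
    then obtain qs where tr: "(g, qs, q) \<in> transitions (enc_preimage A)"
      and qs: "list_all2 (reaches A) (map enc ts) qs"
      by (auto simp: reaches_Fun_iff args)
    have [simp]: "length qs = length ts"
      using list_all2_lengthD[OF qs] by simp
    show ?R
    proof (cases "(g, length ts) \<in> \<Delta>")
      case True
      then show ?thesis
        using tr qs by (auto simp: enc_preimage_def reaches_Fun_iff)
    next
      case False
      then obtain ps where "comb_run A (qs @ ps) q"
        "list_all2 (reaches A) (pad g (length ts) :: ('f, 'v) trm list) ps"
        using tr by (auto simp: enc_preimage_def list_all2_reaches_pad)
      then show ?thesis
        using False qs by (auto simp: reaches_comb_iff intro!: exI[of _ "qs @ ps"] list_all2_appendI)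
    qed
  next
    assume R: ?R
    have q: "q \<in> states A"
      using reaches_state[OF A R] .
    show ?L
    proof (cases "(g, length ts) \<in> \<Delta>")
      case True
      then obtain qs where qs: "(g, qs, q) \<in> transitions A" "list_all2 (reaches A) (map enc ts) qs"
        using R by (auto simp: reaches_Fun_iff)
      have [simp]: "length qs = length ts"
        using list_all2_lengthD[OF qs(2)] by simp
      have "(g, qs, q) \<in> transitions (enc_preimage A)"
        using True qs q mem st by (simp add: enc_preimage_def)
      then show ?thesis
        using qs by (auto simp: reaches_Fun_iff args)
    next
      case False
      then obtain qs ps where qs: "list_all2 (reaches A) (map enc ts) qs"
        and ps: "list_all2 (reaches A) (pad g (length ts) :: ('f, 'v) trm list) ps"
        and run: "comb_run A (qs @ ps) q"
        using R by (auto simp: reaches_comb_iff list_all2_append1)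
      have [simp]: "length qs = length ts"
        using list_all2_lengthD[OF qs] by simp
      have "(g, qs, q) \<in> transitions (enc_preimage A)"
        using False q mem st[OF qs] run ps by (auto simp: enc_preimage_def list_all2_reaches_pad)
      then show ?thesis
        using qs by (auto simp: reaches_Fun_iff args)
    qed
  qed
qed

lemma recognizable_enc_preimage:
  assumes "recognizable ({(f, 2), (sharp, 0)} \<union> \<Delta>) L"
  shows "recognizable \<Gamma> {t \<in> ground_terms \<Gamma>. enc t \<in> L}"
proof -
  obtain A :: "(nat, 'f) tree_automaton" where
    A: "automaton_over ({(f, 2), (sharp, 0)} \<union> \<Delta>) A" and
    L: "L = tree_language ({(f, 2), (sharp, 0)} \<union> \<Delta>) A"
    using assms by (auto simp: recognizable_def)
  have "automaton_over \<Gamma> (enc_preimage A)"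
    using A by (auto simp: automaton_over_def enc_preimage_def)
  moreover have "{t \<in> ground_terms \<Gamma>. enc t \<in> L} = tree_language \<Gamma> (enc_preimage A)"
  proof -
    have "finals (enc_preimage A) = finals A"
      by (simp add: enc_preimage_def)
    then show ?thesis
      using reaches_enc_preimage_iff[OF A] enc_ground_terms
      unfolding L tree_language_def by blast
  qed
  ultimately show ?thesis
    by (auto simp: recognizable_def)
qed

section \<open>Transfer of recognizability to larger alphabets\<close>

lemma descendants_enc:
  assumes "trs_over \<Delta> R" and "\<Delta> \<subseteq> \<Gamma>" and L: "L \<subseteq> ground_terms \<Gamma>"
  shows "descendants \<Gamma> R L =
    {t \<in> ground_terms \<Gamma>. enc t \<in> descendants ({(f, 2), (sharp, 0)} \<union> \<Delta>) R (enc ` L)}"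
proof -
  have sub: "L \<subseteq> terms_over \<Gamma>" "enc ` L \<subseteq> terms_over ({(f, 2), (sharp, 0)} \<union> \<Delta>)"
    using L enc_ground_terms unfolding ground_terms_def by blast+
  \<comment> \<open>Descendants of codes need not be codes, but only codes \<open>enc t\<close> are
    tested here, so \<open>rewrite_steps_enc_iff\<close> suffices.\<close>
  have "t \<in> descendants \<Gamma> R L \<longleftrightarrow> enc t \<in> descendants ({(f, 2), (sharp, 0)} \<union> \<Delta>) R (enc ` L)"
    if "t \<in> ground_terms \<Gamma>" for t
  proof -
    have "t \<in> terms_over \<Gamma>"
      using that by (simp add: ground_terms_def)
    then show ?thesis
      using sub(1) rewrite_steps_enc_iff[OF assms(1)]
      unfolding descendants_eq[OF assms(1,2) sub(1)] descendants_eq[OF assms(1) Un_upper2 sub(2)]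
      by blast
  qed
  then show ?thesis
    using descendants_subset_ground_terms[OF assms] by blast
qed

lemma PGRF_TRS_enc:
  fixes R :: "('f, 'v) trs"
  assumes "trs_over \<Delta> R" and "\<Delta> \<subseteq> \<Gamma>" and "PGRF_TRS ({(f, 2), (sharp, 0)} \<union> \<Delta>) R"
  shows "PGRF_TRS \<Gamma> R"
  unfolding PGRF_TRS_def
proof (intro allI impI)
  fix L :: "('f, 'v) trm set" assume L: "finite L \<and> L \<subseteq> ground_terms \<Gamma>"
  then have "recognizable ({(f, 2), (sharp, 0)} \<union> \<Delta>)
      (descendants ({(f, 2), (sharp, 0)} \<union> \<Delta>) R (enc ` L))"
    using assms(3) enc_ground_terms unfolding PGRF_TRS_def by blast
  then show "recognizable \<Gamma> (descendants \<Gamma> R L)"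
    using L recognizable_enc_preimage by (simp add: descendants_enc[OF assms(1,2)])
qed

end

text \<open>Number the symbols injectively and take distinct positive multiples of a number
  exceeding all ranks.\<close>

lemma ex_comb_lengths:
  fixes \<Gamma> :: "('f \<times> nat) set"
  assumes "finite \<Gamma>"
  shows "\<exists>len :: 'f \<times> nat \<Rightarrow> nat. inj_on len \<Gamma> \<and> (\<forall>(g, k)\<in>\<Gamma>. k \<le> len (g, k))"
proof -
  obtain i :: "'f \<times> nat \<Rightarrow> nat" where i: "inj_on i \<Gamma>"
    using finite_imp_inj_to_nat_seg[OF assms] by blast
  define M where "M = Max (snd ` \<Gamma>)"
  have "k \<le> Suc (i p) * Suc M" if "(g, k) \<in> \<Gamma>" for g k p
  proof -
    have "k \<le> M"
      using that assms unfolding M_def by (intro Max_ge) force+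
    then show ?thesis by simp
  qed
  moreover have "inj_on (\<lambda>p. Suc (i p) * Suc M) \<Gamma>"
    using i by (auto simp: inj_on_def simp del: mult_Suc mult_Suc_right)
  ultimately show ?thesis by blast
qed

theorem mainTheorem16:
  fixes R :: "('f :: infinite, 'v :: countable) trs"
    and \<Sigma> :: "'f alphabet"
    and f sharp :: 'f
  assumes "trs_over (sign R) R"
    and "ranked_alphabet \<Sigma>"
    and "\<Sigma> = {(f, 2), (sharp, 0)} \<union> sign R"
    and "f \<in> symbols_of_rank \<Sigma> 2 - symbols (sign R)"
    and "sharp \<in> symbols_of_rank \<Sigma> 0 - symbols (sign R)"
  shows "PGRF_TRS \<Sigma> R \<longleftrightarrow> PRF_TRS R"
proof
  assume "PRF_TRS R"
  then show "PGRF_TRS \<Sigma> R"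
    using assms(2,3) by (auto simp: PRF_TRS_def)
next
  assume P: "PGRF_TRS \<Sigma> R"
  show "PRF_TRS R"
    unfolding PRF_TRS_def
  proof (intro allI impI)
    fix \<Gamma> :: "'f alphabet" assume \<Gamma>: "ranked_alphabet \<Gamma> \<and> sign R \<subseteq> \<Gamma>"
    \<comment> \<open>Only the lengths depend on \<open>\<Gamma>\<close>; the target alphabet
      \<open>\<Sigma>\<close> of the encoding is the same for every \<open>\<Gamma>\<close>.\<close>
    obtain len :: "'f \<times> nat \<Rightarrow> nat"
      where "inj_on len (\<Gamma> - sign R)" "\<forall>(g, k)\<in>\<Gamma> - sign R. k \<le> len (g, k)"
      using ex_comb_lengths[of "\<Gamma> - sign R"] \<Gamma> by (auto simp: ranked_alphabet_def)
    then interpret comb_coding \<Gamma> "sign R" f sharp len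
      using assms(4,5) by unfold_locales (force simp: symbols_def)+
    show "PGRF_TRS \<Gamma> R"
      using PGRF_TRS_enc[of R] assms(1,3) \<Gamma> P by simp
  qed
qed

end
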